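(* For the hypergeometric-Mittag-Leffler functions ${}_{{}_2F_1}E_{(\alpha,\beta)}(a_1,a_2;b_1;u)$, with $\alpha,\beta\in\mathbb{R}^{+}$, the following integral representation holds: $$\int_{-\infty}^{\infty}e^{-\delta u^2}\;{}_{{}_2F_1}E_{(\alpha,\beta)}(a_1,a_2;b_1;u)\,du=\sqrt{\frac{\pi}{\delta}}\;\;{}_{{}_5F_2}E_{(2\alpha,\beta)}\!\left(\frac{a_1}{2},\frac{a_1+1}{2},\frac{a_2}{2},\frac{a_2+1}{2},\frac12;\;\frac{b_1}{2},\frac{b_1+1}{2};\;\frac{4}{\delta}\right).$$
   Context: $(a)_r=\Gamma(a+r)/\Gamma(a)$ is the Pochhammer symbol. The generalized hypergeometric-Mittag-Leffler functions are given by $${}_{{}_pF_q}E_{(\alpha,\beta)}(a_1,\dots,a_p;b_1,\dots,b_q;u)=\sum_{r=0}^{\infty}\frac{(a_1)_r\cdots(a_p)_r}{(b_1)_r\cdots(b_q)_r}\,\frac{u^r}{\Gamma(\alpha r+\beta)} ;$$ the case $p=2$, $q=1$ is the hypergeometric-Mittag-Leffler function.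
   Formalization: Proved for real δ>0, b₁ not a nonpositive integer, and under the added hypothesis that the right-hand ₅F₂ series converges at 4/δ; for α<3/2 it diverges unless it terminates (e.g. α=β=a₁=a₂=b₁=1), so the claim for all α,β>0 is ill-defined. *)

theory Defs
  imports "HOL-Analysis.Analysis"
begin

text \<open>
  The lists \<open>as\<close> and \<open>bs\<close> hold the upper and lower parameters. The Pochhammer symbol is the rising
  factorial of the library: it agrees with \<open>\<Gamma>(a + r) / \<Gamma>(a)\<close> off the poles of \<open>\<Gamma>\<close> and extends
  it by continuity to upper parameters that are nonpositive integers. The series carries no factor
  \<open>1 / r!\<close>. A lower parameter that is a nonpositive integer has to be excluded by the user.
\<close>

definition hyp_ML_term ::
  "real \<Rightarrow> real \<Rightarrow> complex list \<Rightarrow> complex list \<Rightarrow> complex \<Rightarrow> nat \<Rightarrow> complex" where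
  "hyp_ML_term \<alpha> \<beta> as bs u r =
     (\<Prod>a\<leftarrow>as. pochhammer a r) / (\<Prod>b\<leftarrow>bs. pochhammer b r)
       * (u ^ r / complex_of_real (Gamma (\<alpha> * real r + \<beta>)))"

definition hyp_ML ::
  "real \<Rightarrow> real \<Rightarrow> complex list \<Rightarrow> complex list \<Rightarrow> complex \<Rightarrow> complex" where
  "hyp_ML \<alpha> \<beta> as bs u = (\<Sum>r. hyp_ML_term \<alpha> \<beta> as bs u r)"

end

theory Submission
  imports Defs "HOL-Probability.Probability" "HOL-Real_Asymp.Real_Asymp"
begin

text \<open>
  Integrating the series of the integrand termwise against the Gaussian kills the odd powers, and the
  even ones give the right-hand side by the duplication formula for rising factorials. The exchange
  needs absolute convergence, whereas only convergence of the right-hand series is given. The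
  quotient of consecutive terms of that series behaves like a constant times \<open>k\<^bsup>3 - 2\<alpha>\<^esup>\<close>, so the ratio
  test decides everything except \<open>\<alpha> = 3/2\<close>, \<open>\<delta> = 4/27\<close>. There the terms are asymptotic to
  \<open>C k\<^bsup>s\<^esup>\<close> with complex \<open>s\<close>, and since the argument of \<open>k\<^bsup>s\<^esup>\<close> is nearly constant on
  blocks \<open>[N, (1 + \<epsilon>)N]\<close>, convergence forces \<open>Re s < -1\<close>, that is, absolute convergence. Finally,
  the odd terms are controlled by the even ones because the coefficients satisfy
  \<open>|c\<^bsub>n+1\<^esub>|\<^sup>2 \<le> 4 |c\<^bsub>n\<^esub>| |c\<^bsub>n+2\<^esub>|\<close> for large \<open>n\<close>.
\<close>

section \<open>Growth of Gamma quotients at shifted arguments\<close>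

text \<open>Since \<open>ln \<circ> Gamma\<close> is convex, its slope over
  \<open>[x, x + a]\<close> lies between the slopes over the unit intervals
  \<open>[x - 1, x]\<close> and \<open>[x + a, x + a + 1]\<close>. By the functional equation these
  are \<open>ln (x - 1)\<close> and \<open>ln (x + a)\<close>.\<close>

lemma Gamma_shift_bounds:
  fixes x a :: real
  assumes "x > 1" "a > 0"
  shows "(x - 1) powr a \<le> Gamma (x + a) / Gamma x" "Gamma (x + a) / Gamma x \<le> (x + a) powr a"
proof -
  have Gamma_nonzero: "Gamma y \<noteq> 0" if "y > 0" for y :: real
    using Gamma_real_pos[OF that] by linarith
  define f :: "real \<Rightarrow> real" where "f = ln \<circ> Gamma"
  have f: "convex_on {0<..} f"
    unfolding f_def by (rule log_convex_Gamma_real)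
  have step: "f (y + 1) - f y = ln y" if "y > 0" for y
  proof -
    have "y \<notin> \<int>\<^sub>\<le>\<^sub>0" using that by (auto elim!: nonpos_Ints_cases)
    hence "Gamma (y + 1) = y * Gamma y" by (rule Gamma_plus1)
    thus ?thesis using that by (simp add: f_def ln_mult Gamma_nonzero)
  qed
  have diff: "f (x + a) - f x = ln (Gamma (x + a) / Gamma x)"
    using assms by (simp add: f_def ln_div Gamma_nonzero)
  have pos: "Gamma (x + a) / Gamma x > 0"
    using assms by simp
  have "(f (x - 1) - f x) / ((x - 1) - x) \<le> (f x - f (x + a)) / (x - (x + a))"
    using convex_on_slope_le[OF f, of "x - 1" "x + a" x] assms by simp
  hence "a * ln (x - 1) \<le> ln (Gamma (x + a) / Gamma x)"
    using step[of "x - 1"] assms diff by (simp add: field_simps)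
  thus "(x - 1) powr a \<le> Gamma (x + a) / Gamma x"
    using pos assms by (simp add: powr_def ln_ge_iff)
  have "(f x - f (x + a)) / (x - (x + a)) \<le> (f (x + a) - f (x + a + 1)) / ((x + a) - (x + a + 1))"
    using convex_on_slope_le[OF f, of x "x + a + 1" "x + a"] assms by simp
  hence "ln (Gamma (x + a) / Gamma x) \<le> a * ln (x + a)"
    using step[of "x + a"] assms diff by (simp add: field_simps)
  hence "exp (ln (Gamma (x + a) / Gamma x)) \<le> exp (a * ln (x + a))"
    by simp
  thus "Gamma (x + a) / Gamma x \<le> (x + a) powr a"
    using pos assms by (simp add: powr_def)
qed

lemma Gamma_shift_asymp:
  fixes a :: real
  assumes "a > 0"
  shows "((\<lambda>x. Gamma (x + a) / Gamma x / x powr a) \<longlongrightarrow> 1) at_top"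
proof (rule tendsto_sandwich)
  show "\<forall>\<^sub>F x in at_top. (x - 1) powr a / x powr a \<le> Gamma (x + a) / Gamma x / x powr a"
    using eventually_gt_at_top[of 1]
    by eventually_elim (intro divide_right_mono Gamma_shift_bounds assms, auto)
  show "\<forall>\<^sub>F x in at_top. Gamma (x + a) / Gamma x / x powr a \<le> (x + a) powr a / x powr a"
    using eventually_gt_at_top[of 1]
    by eventually_elim (intro divide_right_mono Gamma_shift_bounds assms, auto)
  show "((\<lambda>x. (x - 1) powr a / x powr a) \<longlongrightarrow> 1) at_top"
    using assms by real_asymp
  show "((\<lambda>x. (x + a) powr a / x powr a) \<longlongrightarrow> 1) at_top"
    using assms by real_asymp
qed

section \<open>Convergence tests and comparison with complex powers\<close>

lemma summable_powr_asymp_imp_Re_less: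
  fixes t :: "nat \<Rightarrow> complex"
  assumes lim: "(\<lambda>k. t k / of_nat k powr s) \<longlonglongrightarrow> C" and "C \<noteq> 0" and t: "summable t"
  shows "Re s < -1"
proof (rule ccontr)
  assume "\<not> Re s < -1"
  define h where "h k = t k / of_nat k powr s / C" for k
  have "h \<longlonglongrightarrow> C / C"
    unfolding h_def by (intro tendsto_divide lim tendsto_const assms)
  hence h: "h \<longlonglongrightarrow> 1" using \<open>C \<noteq> 0\<close> by simp
  \<comment> \<open>Joint continuity gives one radius that controls both perturbations of a term:
    the factor \<open>h k\<close>, close to 1, and the power of \<open>k / N\<close>, close to 1 on
    a short block.\<close>
  have "isCont (\<lambda>p :: complex \<times> complex. fst p * snd p powr s) (1, 1)"
    by (intro continuous_intros) auto
  then obtain d where d: "d > 0"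
    "\<And>p. dist p (1, 1) < d \<Longrightarrow> dist (fst p * snd p powr s) (1 * 1 powr s) < 1 / 2"
    unfolding continuous_at_eps_delta
    by (metis fst_conv half_gt_zero_iff snd_conv zero_less_one)
  have near: "norm (a * w powr s - 1) < 1 / 2" if "norm (a - 1) < d / 2" "norm (w - 1) < d / 2" for a w
  proof -
    have "dist (a, w) (1, 1) \<le> dist a 1 + dist w 1"
      unfolding dist_prod_def by (auto intro: order_trans[OF sqrt_sum_squares_le_sum])
    also have "\<dots> < d" using that by (simp add: dist_norm)
    finally show ?thesis using d(2)[of "(a, w)"] by (simp add: dist_norm)
  qed
  \<comment> \<open>The relative length of the block: it keeps \<open>k / N\<close> within
    \<open>d / 2\<close> of 1.\<close>
  define e where "e = min (d / 4) 1"
  have e: "e > 0" "e < d / 2" using d(1) by (auto simp: e_def)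
  obtain N0 where N0: "\<And>k. k \<ge> N0 \<Longrightarrow> norm (h k - 1) < d / 2"
    using LIMSEQ_D[OF h, of "d / 2"] d(1) by auto
  \<comment> \<open>The tolerance is half of \<open>e * norm C / 2\<close>, the lower bound that the
    block sum will be shown to satisfy.\<close>
  obtain N1 where N1: "\<And>m n. m \<ge> N1 \<Longrightarrow> norm (sum t {m..<n}) < e * norm C / 4"
    using t \<open>C \<noteq> 0\<close> e unfolding summable_Cauchy
    by (metis divide_pos_pos mult_pos_pos zero_less_norm_iff zero_less_numeral)
  define N where "N = N0 + N1 + 1"
  define m where "m = nat \<lceil>e * real N\<rceil>"
  have m: "real m \<ge> e * real N" "real m < e * real N + 1"
    using e by (auto simp: m_def N_def) linarith
  have Nne: "of_nat N \<noteq> (0::complex)" "real N \<ge> 1"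
    unfolding of_nat_eq_0_iff by (auto simp: N_def)
  \<comment> \<open>The common approximate value of the terms in the block. After division by
    \<open>Z\<close> each term has real part at least 1/2, so the terms cannot cancel.\<close>
  define Z where "Z = C * of_nat N powr s"
  have block: "Re (t k / Z) \<ge> 1 / 2" if k: "k \<in> {N..<N + m}" for k
  proof -
    define w where "w = complex_of_real (real k / real N)"
    \<comment> \<open>Although \<open>m\<close> is rounded up, \<open>k \<le> N + m - 1\<close> and
      \<open>m - 1 < e * N\<close> keep \<open>k\<close> strictly below
      \<open>N + e * N\<close>.\<close>
    have kN: "real k \<ge> real N" "real k < real N + e * real N"
      using k m(2) by auto
    have w: "norm (w - 1) < d / 2"
    proof -
      have "norm (w - 1) = \<bar>real k / real N - 1\<bar>"
        unfolding w_def by (metis norm_of_real of_real_1 of_real_diff)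
      also have "\<dots> \<le> e" using kN Nne by (simp add: field_simps abs_if)
      finally show ?thesis using e by simp
    qed
    have k0: "k > 0" "k \<ge> N0" using k by (auto simp: N_def)
    have "of_nat k = w * of_nat N" using Nne by (simp add: w_def)
    \<comment> \<open>A complex power of a product splits here because both bases are nonnegative
      reals.\<close>
    moreover have "(w * of_nat N) powr s = w powr s * of_nat N powr s"
      using k0 Nne by (intro powr_times_real) (auto simp: w_def)
    moreover have "t k = h k * C * of_nat k powr s"
      using k0 \<open>C \<noteq> 0\<close> by (simp add: h_def)
    ultimately have "t k = h k * C * (w powr s * of_nat N powr s)"
      by simp
    hence "t k / Z = h k * w powr s"
      using Nne \<open>C \<noteq> 0\<close> by (simp add: Z_def)
    hence "norm (t k / Z - 1) < 1 / 2"
      using near[OF N0[OF k0(2)] w] by simp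
    thus ?thesis
      using complex_Re_le_cmod[of "1 - t k / Z"] by (simp add: norm_minus_commute)
  qed
  have "real m / 2 = (\<Sum>k\<in>{N..<N + m}. 1 / 2)" by simp
  also have "\<dots> \<le> (\<Sum>k\<in>{N..<N + m}. Re (t k / Z))"
    by (intro sum_mono block)
  also have "\<dots> = Re (sum t {N..<N + m} / Z)"
    by (simp add: sum_divide_distrib)
  also have "\<dots> \<le> norm (sum t {N..<N + m}) / norm Z"
    using complex_Re_le_cmod by (metis norm_divide)
  finally have "real m / 2 * norm Z \<le> norm (sum t {N..<N + m})"
    using Nne \<open>C \<noteq> 0\<close> by (simp add: Z_def field_simps)
  also have "\<dots> < e * norm C / 4"
    by (rule N1) (simp add: N_def)
  finally have "real m * norm Z < e * norm C / 2" by simp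
  moreover have "e * norm C \<le> real m * norm Z"
  proof -
    \<comment> \<open>The assumption \<open>Re s \<ge> -1\<close> enters here: about
      \<open>e * N\<close> terms of size \<open>norm C * N powr Re s\<close> have total size at
      least \<open>e * norm C\<close>.\<close>
    have "1 \<le> real N powr (1 + Re s)"
      using Nne \<open>\<not> Re s < -1\<close> by (intro ge_one_powr_ge_zero) auto
    also have "\<dots> = real N * norm (of_nat N powr s :: complex)"
      using Nne norm_powr_real_powr[of "of_nat N" s] by (simp add: powr_add)
    finally have "e * norm C * 1 \<le> e * norm C * (real N * norm (of_nat N powr s :: complex))"
      using e by (intro mult_left_mono) auto
    also have "\<dots> = (e * real N) * norm Z"
      by (simp add: Z_def norm_mult)
    also have "\<dots> \<le> real m * norm Z"
      using m by (intro mult_right_mono) auto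
    finally show ?thesis by simp
  qed
  moreover have "e * norm C > 0" using e \<open>C \<noteq> 0\<close> by simp
  ultimately show False by simp
qed

lemma norm_add_of_nat_asymp:
  fixes a :: complex
  shows "(\<lambda>n. norm (a + of_nat n) / real n) \<longlonglongrightarrow> 1"
proof -
  have "(\<lambda>n. norm (a / of_nat n + 1)) \<longlonglongrightarrow> norm (0 + 1 :: complex)"
    by (intro tendsto_intros lim_const_over_n)
  moreover have "\<forall>\<^sub>F n in sequentially. norm (a / of_nat n + 1) = norm (a + of_nat n) / real n"
    using eventually_gt_at_top[of 0]
  proof eventually_elim
    case (elim n)
    hence "a / of_nat n + 1 = (a + of_nat n) / of_nat n" by (simp add: field_simps)
    thus ?case by (simp add: norm_divide)
  qed
  ultimately show ?thesis by (simp add: tendsto_cong)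
qed

lemma norm_summable_ratio_limit:
  fixes t :: "nat \<Rightarrow> 'a::banach"
  assumes lim: "(\<lambda>k. norm (t (Suc k)) / norm (t k)) \<longlonglongrightarrow> l" and "l < 1" and nz: "\<And>k. t k \<noteq> 0"
  shows "summable (\<lambda>k. norm (t k))"
proof -
  obtain c where c: "l < c" "c < 1" using dense[OF \<open>l < 1\<close>] by blast
  obtain N where "\<And>k. k \<ge> N \<Longrightarrow> norm (t (Suc k)) / norm (t k) < c"
    using order_tendstoD(2)[OF lim c(1)] unfolding eventually_sequentially by blast
  hence "norm (norm (t (Suc k))) \<le> c * norm (norm (t k))" if "k \<ge> N" for k
    using nz[of k] that by (simp add: divide_simps less_imp_le)
  thus ?thesis by (rule summable_ratio_test[OF c(2)])
qed

lemma not_summable_ratio_ge_1: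
  fixes t :: "nat \<Rightarrow> 'a::real_normed_vector"
  assumes ev: "\<forall>\<^sub>F k in sequentially. norm (t (Suc k)) / norm (t k) \<ge> 1" and nz: "\<And>k. t k \<noteq> 0"
  shows "\<not> summable t"
proof
  assume "summable t"
  hence lim: "(\<lambda>k. norm (t k)) \<longlonglongrightarrow> 0"
    by (intro tendsto_norm_zero summable_LIMSEQ_zero)
  obtain N where N: "\<And>k. k \<ge> N \<Longrightarrow> norm (t (Suc k)) / norm (t k) \<ge> 1"
    using ev unfolding eventually_sequentially by blast
  have "norm (t N) \<le> norm (t k)" if "k \<ge> N" for k
    using that
  proof (induction k rule: dec_induct)
    case (step k)
    thus ?case using N[of k] nz[of k] by (simp add: divide_simps)
  qed simp
  hence "norm (t N) \<le> 0"
    by (intro tendsto_lowerbound[OF lim]) (auto simp: eventually_sequentially)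
  thus False using nz by simp
qed

text \<open>Conditional convergence is impossible on this scale: convergence forces
  \<open>Re s < -1\<close>, and then the norms are dominated by a convergent series of real
  powers.\<close>

lemma norm_summable_powr_asymp:
  fixes t :: "nat \<Rightarrow> complex"
  assumes lim: "(\<lambda>k. t k / of_nat k powr s) \<longlonglongrightarrow> C" and "C \<noteq> 0" and t: "summable t"
  shows "summable (\<lambda>k. norm (t k))"
proof -
  have s: "Re s < -1" using assms by (rule summable_powr_asymp_imp_Re_less)
  have "\<forall>\<^sub>F k in sequentially. norm (t k / of_nat k powr s) < norm C + 1"
    by (intro order_tendstoD[OF tendsto_norm[OF lim]]) simp
  hence "\<forall>\<^sub>F k in sequentially. norm (norm (t k)) \<le> (norm C + 1) * real k powr Re s"
    using eventually_gt_at_top[of 0]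
  proof eventually_elim
    case (elim k)
    thus ?case
      using norm_powr_real_powr[of "of_nat k" s] by (simp add: norm_divide divide_simps split: if_splits)
  qed
  thus ?thesis
    by (rule summable_comparison_test_ev)
      (intro summable_mult, simp add: summable_real_powr_iff s)
qed

section \<open>Asymptotics and multiplication of Pochhammer symbols\<close>

text \<open>In the quotient of the two product approximations of Gamma the factorials cancel, and
  the remaining powers of \<open>n\<close> combine to the exponent \<open>a - b\<close>.\<close>

lemma pochhammer_quotient_asymp:
  fixes a b :: complex
  assumes "a \<notin> \<int>\<^sub>\<le>\<^sub>0" "b \<notin> \<int>\<^sub>\<le>\<^sub>0"
  shows "(\<lambda>n. pochhammer a n / pochhammer b n / of_nat n powr (a - b)) \<longlonglongrightarrow> Gamma b / Gamma a"
proof -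
  have "(\<lambda>n. Gamma_series' b n / Gamma_series' a n) \<longlonglongrightarrow> Gamma b / Gamma a"
    using assms by (intro tendsto_divide Gamma_series'_LIMSEQ) (simp add: Gamma_eq_zero_iff)
  moreover have "\<forall>\<^sub>F n in sequentially. Gamma_series' b n / Gamma_series' a n =
      pochhammer a n / pochhammer b n / of_nat n powr (a - b)"
    using eventually_gt_at_top[of 0]
  proof eventually_elim
    case (elim n)
    thus ?case
      by (simp add: Gamma_series'_def powr_def field_simps exp_diff flip: Ln_of_nat)
  qed
  ultimately show ?thesis by (rule Lim_transform_eventually)
qed

text \<open>Equal lengths allow the parameters to be paired, so that no factorial growth survives
  and the exponents add up. This gives the asymptotics of the terms where the ratio test is
  silent.\<close>

lemma pochhammer_quotients_asymp:
  fixes as bs :: "complex list"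
  assumes "length as = length bs" "set as \<inter> \<int>\<^sub>\<le>\<^sub>0 = {}" "set bs \<inter> \<int>\<^sub>\<le>\<^sub>0 = {}"
  shows "(\<lambda>n. (\<Prod>a\<leftarrow>as. pochhammer a n) / (\<Prod>b\<leftarrow>bs. pochhammer b n) /
            of_nat n powr (sum_list as - sum_list bs)) \<longlonglongrightarrow> (\<Prod>b\<leftarrow>bs. Gamma b) / (\<Prod>a\<leftarrow>as. Gamma a)"
  using assms
proof (induction as bs rule: list_induct2)
  case Nil
  have "\<forall>\<^sub>F n in sequentially. 1 = 1 / of_nat n powr (0 :: complex)"
    using eventually_gt_at_top[of 0] by eventually_elim simp
  from Lim_transform_eventually[OF tendsto_const this] show ?case by simp
next
  case (Cons a as b bs)
  let ?q = "\<lambda>n. (\<Prod>a\<leftarrow>as. pochhammer a n) / (\<Prod>b\<leftarrow>bs. pochhammer b n) /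
              of_nat n powr (sum_list as - sum_list bs)"
  have "(\<lambda>n. pochhammer a n / pochhammer b n / of_nat n powr (a - b) * ?q n) \<longlonglongrightarrow>
      Gamma b / Gamma a * ((\<Prod>b\<leftarrow>bs. Gamma b) / (\<Prod>a\<leftarrow>as. Gamma a))"
    using Cons by (intro tendsto_mult pochhammer_quotient_asymp) auto
  moreover have "pochhammer a n / pochhammer b n / of_nat n powr (a - b) * ?q n =
      (\<Prod>a\<leftarrow>a # as. pochhammer a n) / (\<Prod>b\<leftarrow>b # bs. pochhammer b n) /
        of_nat n powr (sum_list (a # as) - sum_list (b # bs))" for n
  proof -
    have "sum_list (a # as) - sum_list (b # bs) = (a - b) + (sum_list as - sum_list bs)"
      by simp
    thus ?thesis by (simp only: powr_add) simp
  qed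
  ultimately show ?case by (simp only: list.map prod_list.Cons times_divide_times_eq)
qed

text \<open>The Pochhammer form of the Gauss multiplication formula for three factors. For
  \<open>2 * \<alpha> = 3\<close> it turns the Gamma factor of the series into Pochhammer
  symbols.\<close>

lemma pochhammer_triple:
  fixes z :: "'a::field_char_0"
  shows "pochhammer (3 * z) (3 * n) =
    27 ^ n * pochhammer z n * pochhammer (z + 1 / 3) n * pochhammer (z + 2 / 3) n"
proof (induction n)
  case (Suc n)
  have "3 * Suc n = Suc (Suc (Suc (3 * n)))" by simp
  hence "pochhammer (3 * z) (3 * Suc n) = pochhammer (3 * z) (3 * n) *
      ((3 * z + 3 * of_nat n) * (3 * z + 3 * of_nat n + 1) * (3 * z + 3 * of_nat n + 2))"
    by (simp only: pochhammer_Suc) (simp add: algebra_simps)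
  also have "(3 * z + 3 * of_nat n) * (3 * z + 3 * of_nat n + 1) * (3 * z + 3 * of_nat n + 2) =
      27 * ((z + of_nat n) * (z + 1 / 3 + of_nat n) * (z + 2 / 3 + of_nat n))"
    by (simp add: field_simps)
  finally show ?case
    unfolding Suc.IH pochhammer_Suc power_Suc by (simp only: mult_ac)
qed simp

section \<open>Coefficients of the series of the integrand\<close>

lemma hyp_ML_term_eq_coeff_mult_power:
  "hyp_ML_term \<alpha> \<beta> as bs u r = hyp_ML_term \<alpha> \<beta> as bs 1 r * u ^ r"
  by (simp add: hyp_ML_term_def)

lemma pochhammer_nonzero:
  fixes a :: complex
  assumes "a \<notin> \<int>\<^sub>\<le>\<^sub>0"
  shows "pochhammer a n \<noteq> 0"
  using assms by (auto simp: pochhammer_eq_0_iff)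

lemma hyp_ML_term_nonzero:
  assumes "\<alpha> > 0" "\<beta> > 0" "a1 \<notin> \<int>\<^sub>\<le>\<^sub>0" "a2 \<notin> \<int>\<^sub>\<le>\<^sub>0" "b1 \<notin> \<int>\<^sub>\<le>\<^sub>0"
  shows "hyp_ML_term \<alpha> \<beta> [a1, a2] [b1] 1 n \<noteq> 0"
proof -
  have "Gamma (\<alpha> * real n + \<beta>) > 0"
    using assms by (intro Gamma_real_pos add_nonneg_pos) auto
  thus ?thesis
    using assms by (simp add: hyp_ML_term_def pochhammer_nonzero del: Gamma_real_pos)
qed

text \<open>With \<open>x n = \<alpha> * n + \<beta>\<close>, the Pochhammer symbols contribute a
  factor asymptotic to \<open>n\<close>, and \<open>Gamma (x n) / Gamma (x n + \<alpha>)\<close> one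
  asymptotic to \<open>(\<alpha> * n) powr (-\<alpha>)\<close>.\<close>

lemma hyp_ML_coeff_ratio_asymp:
  assumes "\<alpha> > 0" "\<beta> > 0" and nonpos: "a1 \<notin> \<int>\<^sub>\<le>\<^sub>0" "a2 \<notin> \<int>\<^sub>\<le>\<^sub>0" "b1 \<notin> \<int>\<^sub>\<le>\<^sub>0"
  defines "c \<equiv> hyp_ML_term \<alpha> \<beta> [a1, a2] [b1] 1"
  shows "(\<lambda>n. norm (c (Suc n)) / norm (c n) * real n powr (\<alpha> - 1)) \<longlonglongrightarrow> (1 / \<alpha>) powr \<alpha>"
proof -
  define x where "x n = \<alpha> * real n + \<beta>" for n
  define g where "g y = Gamma (y + \<alpha>) / Gamma y / y powr \<alpha>" for y
  have x: "filterlim x at_top sequentially"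
    unfolding x_def using assms by real_asymp
  have g: "(\<lambda>n. g (x n)) \<longlonglongrightarrow> 1"
    unfolding g_def by (rule filterlim_compose[OF Gamma_shift_asymp[OF \<open>\<alpha> > 0\<close>] x])
  have "(\<lambda>n. real n / x n) \<longlonglongrightarrow> 1 / \<alpha>"
    unfolding x_def using assms by (real_asymp simp: field_simps)
  hence nx: "(\<lambda>n. (real n / x n) powr \<alpha>) \<longlonglongrightarrow> (1 / \<alpha>) powr \<alpha>"
    using assms by (intro tendsto_powr tendsto_const) auto
  have "(\<lambda>n. (norm (a1 + of_nat n) / real n) * (norm (a2 + of_nat n) / real n) /
      (norm (b1 + of_nat n) / real n) * ((real n / x n) powr \<alpha> / g (x n))) \<longlonglongrightarrow>
      1 * 1 / 1 * ((1 / \<alpha>) powr \<alpha> / 1)"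
    by (intro nx g norm_add_of_nat_asymp tendsto_mult tendsto_divide) auto
  moreover have "\<forall>\<^sub>F n in sequentially.
      (norm (a1 + of_nat n) / real n) * (norm (a2 + of_nat n) / real n) /
      (norm (b1 + of_nat n) / real n) * ((real n / x n) powr \<alpha> / g (x n)) =
      norm (c (Suc n)) / norm (c n) * real n powr (\<alpha> - 1)"
    using eventually_gt_at_top[of 0]
  proof eventually_elim
    case (elim n)
    have pos: "x n > 0" using assms unfolding x_def by (intro add_nonneg_pos) auto
    have G: "Gamma (x n) > 0" "Gamma (x n + \<alpha>) > 0" using pos assms by auto
    have xSuc: "x (Suc n) = x n + \<alpha>" by (simp add: x_def algebra_simps)
    have cn: "norm (c m) = norm (pochhammer a1 m) * norm (pochhammer a2 m) / norm (pochhammer b1 m) /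
        Gamma (x m)" for m
    proof -
      have "Gamma (x m) > 0" using assms unfolding x_def by (intro Gamma_real_pos add_nonneg_pos) auto
      thus ?thesis by (simp add: c_def hyp_ML_term_def norm_mult norm_divide x_def)
    qed
    have p: "norm (pochhammer a1 n) > 0" "norm (pochhammer a2 n) > 0" "norm (pochhammer b1 n) > 0"
      using nonpos by (simp_all add: pochhammer_nonzero)
    have "norm (c (Suc n)) / norm (c n) =
        norm (a1 + of_nat n) * norm (a2 + of_nat n) / norm (b1 + of_nat n) * (Gamma (x n) / Gamma (x n + \<alpha>))"
      using p G unfolding cn xSuc pochhammer_Suc norm_mult by (simp add: field_simps)
    moreover have "(real n / x n) powr \<alpha> / g (x n) =
        real n * real n powr (\<alpha> - 1) * (Gamma (x n) / Gamma (x n + \<alpha>))"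
      using elim pos G by (simp add: g_def powr_divide powr_diff)
    ultimately show ?case using elim by simp
  qed
  ultimately show ?thesis by (simp add: Lim_transform_eventually)
qed

text \<open>An upper parameter \<open>-m\<close> terminates the series after index \<open>m\<close>.
  This case is separated because quotients of consecutive terms are then meaningless.\<close>

lemma hyp_ML_coeff_eventually_0:
  assumes "a1 \<in> \<int>\<^sub>\<le>\<^sub>0 \<or> a2 \<in> \<int>\<^sub>\<le>\<^sub>0"
  shows "\<forall>\<^sub>F n in sequentially. hyp_ML_term \<alpha> \<beta> [a1, a2] [b1] 1 n = 0"
proof -
  obtain m where m: "a1 = - of_nat m \<or> a2 = - of_nat m"
    using assms by (auto elim!: nonpos_Ints_cases')
  show ?thesis
    using eventually_gt_at_top[of m]
    by eventually_elim (use m in \<open>auto simp: hyp_ML_term_def pochhammer_eq_0_iff\<close>)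
qed

text \<open>In the nonterminating case the quotient of the two sides without the 4 is
  \<open>r n / r (Suc n)\<close>, which tends to 1, so any constant above 1 would do. The value 4
  fits the later use of \<open>4 * x * z \<le> (x + z)\<^sup>2\<close>.\<close>

lemma hyp_ML_coeff_square_le:
  fixes a1 a2 b1 :: complex
  assumes "\<alpha> > 0" "\<beta> > 0" "b1 \<notin> \<int>\<^sub>\<le>\<^sub>0"
  defines "c \<equiv> hyp_ML_term \<alpha> \<beta> [a1, a2] [b1] 1"
  shows "\<forall>\<^sub>F n in sequentially. (norm (c (Suc n)))\<^sup>2 \<le> 4 * norm (c n) * norm (c (Suc (Suc n)))"
proof (cases "a1 \<in> \<int>\<^sub>\<le>\<^sub>0 \<or> a2 \<in> \<int>\<^sub>\<le>\<^sub>0")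
  case True
  have "\<forall>\<^sub>F n in sequentially. c (Suc n) = 0"
    using hyp_ML_coeff_eventually_0[OF True] unfolding c_def
    by (rule eventually_compose_filterlim[OF _ filterlim_Suc])
  thus ?thesis by eventually_elim simp
next
  case False
  define r where "r n = norm (c (Suc n)) / norm (c n)" for n
  define L where "L = (1 / \<alpha>) powr \<alpha>"
  have "L > 0" using assms by (simp add: L_def)
  have r: "(\<lambda>n. r n * real n powr (\<alpha> - 1)) \<longlonglongrightarrow> L"
    using hyp_ML_coeff_ratio_asymp[of \<alpha> \<beta> a1 a2 b1] assms False by (simp add: r_def L_def)
  have c: "c n \<noteq> 0" for n
    using hyp_ML_term_nonzero[of \<alpha> \<beta> a1 a2 b1] assms False by simp
  have "(\<lambda>n. (real (Suc n) / real n) powr (\<alpha> - 1)) \<longlonglongrightarrow> 1 powr (\<alpha> - 1)"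
    by (intro tendsto_powr tendsto_const) (real_asymp | simp)+
  \<comment> \<open>For positive \<open>n\<close> this expression equals
    \<open>r n / r (Suc n)\<close>: the last power compensates the different normalisations of the
    two ratios.\<close>
  hence "(\<lambda>n. (r n * real n powr (\<alpha> - 1)) / (r (Suc n) * real (Suc n) powr (\<alpha> - 1)) *
      (real (Suc n) / real n) powr (\<alpha> - 1)) \<longlonglongrightarrow> L / L * 1 powr (\<alpha> - 1)"
    using \<open>L > 0\<close> LIMSEQ_Suc[OF r] by (intro tendsto_mult tendsto_divide r) auto
  hence "\<forall>\<^sub>F n in sequentially. (r n * real n powr (\<alpha> - 1)) / (r (Suc n) * real (Suc n) powr (\<alpha> - 1)) *
      (real (Suc n) / real n) powr (\<alpha> - 1) < 4"
    using \<open>L > 0\<close> by (intro order_tendstoD(2)) auto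
  thus ?thesis
    using eventually_gt_at_top[of 0]
  proof eventually_elim
    case (elim n)
    hence "r n / r (Suc n) < 4"
      by (simp add: powr_divide del: of_nat_Suc)
    moreover have "norm (c n) > 0" "norm (c (Suc n)) > 0" "norm (c (Suc (Suc n))) > 0"
      using c by auto
    ultimately show ?case
      by (simp add: r_def field_simps power2_eq_square)
  qed
qed

section \<open>Absolute convergence of the series on the right-hand side\<close>

text \<open>Duplication gives a factor \<open>4 ^ k\<close> for each of \<open>a1\<close>,
  \<open>a2\<close>, \<open>b1\<close>; two stand above and one below, which explains the 4 in
  \<open>4 / \<delta>\<close>. The parameter 1/2 supplies the factor of the Gaussian moment.\<close>

lemma hyp_ML_term_even:
  assumes "\<delta> > 0"
  shows "hyp_ML_term (2 * \<alpha>) \<beta> [a1 / 2, (a1 + 1) / 2, a2 / 2, (a2 + 1) / 2, 1 / 2] [b1 / 2, (b1 + 1) / 2]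
           (complex_of_real (4 / \<delta>)) k =
         hyp_ML_term \<alpha> \<beta> [a1, a2] [b1] 1 (2 * k) * of_real (pochhammer (1 / 2) k / \<delta> ^ k)"
proof -
  have double: "pochhammer a (2 * k) = 4 ^ k * (pochhammer (a / 2) k * pochhammer ((a + 1) / 2) k)"
    for a :: complex
    using pochhammer_double[of "a / 2" k] by (simp add: add_divide_distrib power_mult)
  have half: "complex_of_real (pochhammer (1 / 2) k) = pochhammer (1 / 2) k"
    by (simp flip: pochhammer_of_real)
  show ?thesis
    unfolding hyp_ML_term_def
    by (simp add: double half power_divide) (simp add: mult_ac)
qed

lemma hyp_ML_even_norm_summable:
  fixes a1 a2 b1 :: complex
  assumes pos: "\<alpha> > 0" "\<beta> > 0" "\<delta> > 0" and b1: "b1 \<notin> \<int>\<^sub>\<le>\<^sub>0"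
  defines "t \<equiv> hyp_ML_term (2 * \<alpha>) \<beta> [a1 / 2, (a1 + 1) / 2, a2 / 2, (a2 + 1) / 2, 1 / 2]
                 [b1 / 2, (b1 + 1) / 2] (complex_of_real (4 / \<delta>))"
  assumes t: "summable t"
  shows "summable (\<lambda>k. norm (t k))"
proof (cases "a1 \<in> \<int>\<^sub>\<le>\<^sub>0 \<or> a2 \<in> \<int>\<^sub>\<le>\<^sub>0")
  case True
  have "\<forall>\<^sub>F k in sequentially. hyp_ML_term \<alpha> \<beta> [a1, a2] [b1] 1 (2 * k) = 0"
    by (rule eventually_compose_filterlim[OF hyp_ML_coeff_eventually_0[OF True]]) real_asymp
  hence "\<forall>\<^sub>F k in sequentially. norm (t k) = 0"
    by eventually_elim (simp only: t_def hyp_ML_term_even[OF \<open>\<delta> > 0\<close>] mult_zero_left norm_zero)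
  from summable_cong[OF this] show ?thesis by simp
next
  case False
  define c where "c = hyp_ML_term \<alpha> \<beta> [a1, a2] [b1] 1"
  define r where "r n = norm (c (Suc n)) / norm (c n)" for n
  define L where "L = (1 / \<alpha>) powr \<alpha>"
  have "L > 0" using pos by (simp add: L_def)
  have r: "(\<lambda>n. r n * real n powr (\<alpha> - 1)) \<longlonglongrightarrow> L"
    using hyp_ML_coeff_ratio_asymp[of \<alpha> \<beta> a1 a2 b1] pos b1 False by (simp add: r_def L_def c_def)
  have c: "c n \<noteq> 0" for n
    using hyp_ML_term_nonzero[of \<alpha> \<beta> a1 a2 b1] pos b1 False by (simp add: c_def)
  have half: "pochhammer (1 / 2 :: real) k > 0" for k
    by (rule pochhammer_pos) simp
  have t_eq: "t k = c (2 * k) * of_real (pochhammer (1 / 2) k / \<delta> ^ k)" for k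
    unfolding t_def c_def by (rule hyp_ML_term_even[OF \<open>\<delta> > 0\<close>])
  have nz: "t k \<noteq> 0" for k
    using c half[of k] pos by (simp add: t_eq)
  define \<rho> where "\<rho> k = norm (t (Suc k)) / norm (t k)" for k
  have norm_t: "norm (t k) = norm (c (2 * k)) * (pochhammer (1 / 2) k / \<delta> ^ k)" for k
    using half[of k] pos unfolding t_eq norm_mult norm_of_real by simp
  have \<rho>: "\<rho> k = r (2 * k) * r (2 * k + 1) * (real k + 1 / 2) / \<delta>" for k
    using c[of "2 * k"] c[of "2 * k + 1"] half[of k] pos
    by (simp add: \<rho>_def norm_t r_def pochhammer_Suc field_simps)
  \<comment> \<open>The two ratios in \<open>\<rho> k\<close> behave like
    \<open>L * (2 * k) powr (1 - \<alpha>)\<close> and the last factor like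
    \<open>k / \<delta>\<close>. Hence \<open>\<rho> k\<close> is asymptotic to
    \<open>M * k powr (3 - 2 * \<alpha>)\<close>.\<close>
  define M where "M = L * L * (1 / 2 powr (2 * \<alpha> - 2)) / \<delta>"
  have "M > 0" using \<open>L > 0\<close> pos by (simp add: M_def)
  have \<rho>_lim: "(\<lambda>k. \<rho> k * real k powr (2 * \<alpha> - 3)) \<longlonglongrightarrow> M"
  proof -
    have ev: "(\<lambda>k. r (2 * k) * real (2 * k) powr (\<alpha> - 1)) \<longlonglongrightarrow> L"
      by (rule filterlim_compose[OF r]) real_asymp
    have od: "(\<lambda>k. r (2 * k + 1) * real (2 * k + 1) powr (\<alpha> - 1)) \<longlonglongrightarrow> L"
      by (rule filterlim_compose[OF r]) real_asymp
    have "(\<lambda>k. (real k / real (2 * k)) powr (\<alpha> - 1) * (real k / real (2 * k + 1)) powr (\<alpha> - 1) *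
        ((real k + 1 / 2) / real k)) \<longlonglongrightarrow> (1 / 2) powr (\<alpha> - 1) * (1 / 2) powr (\<alpha> - 1) * 1"
      by (intro tendsto_mult tendsto_powr tendsto_const) (real_asymp | simp)+
    also have "(1 / 2) powr (\<alpha> - 1) * (1 / 2) powr (\<alpha> - 1) * 1 = 1 / 2 powr (2 * \<alpha> - 2)"
      by (simp add: powr_divide flip: powr_add)
    finally have "(\<lambda>k. (r (2 * k) * real (2 * k) powr (\<alpha> - 1)) *
        (r (2 * k + 1) * real (2 * k + 1) powr (\<alpha> - 1)) *
        ((real k / real (2 * k)) powr (\<alpha> - 1) * (real k / real (2 * k + 1)) powr (\<alpha> - 1) *
        ((real k + 1 / 2) / real k)) / \<delta>) \<longlonglongrightarrow> M"
      unfolding M_def using pos by (intro tendsto_mult tendsto_divide ev od tendsto_const) auto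
    moreover have "\<forall>\<^sub>F k in sequentially. (r (2 * k) * real (2 * k) powr (\<alpha> - 1)) *
        (r (2 * k + 1) * real (2 * k + 1) powr (\<alpha> - 1)) *
        ((real k / real (2 * k)) powr (\<alpha> - 1) * (real k / real (2 * k + 1)) powr (\<alpha> - 1) *
        ((real k + 1 / 2) / real k)) / \<delta> = \<rho> k * real k powr (2 * \<alpha> - 3)"
      using eventually_gt_at_top[of 0]
    proof eventually_elim
      case (elim k)
      have cancel: "y powr (\<alpha> - 1) * (x / y) powr (\<alpha> - 1) = x powr (\<alpha> - 1)"
        if "x > 0" "y > 0" for x y :: real
        using that by (simp add: powr_divide)
      have "real k powr (2 * \<alpha> - 3) = real k powr (\<alpha> - 1) * real k powr (\<alpha> - 1) / real k"
      proof -
        have "real k powr (2 * \<alpha> - 3) = real k powr ((\<alpha> - 1) + (\<alpha> - 1) - 1)" by simp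
        thus ?thesis using elim by (simp only: powr_diff powr_add) simp
      qed
      thus ?case
        using cancel[of "real k" "real (2 * k)"] cancel[of "real k" "real (2 * k + 1)"] elim
        unfolding \<rho> by (simp only: ) (simp add: field_simps)
    qed
    ultimately show ?thesis by (rule Lim_transform_eventually)
  qed
  have \<rho>_eq: "\<forall>\<^sub>F k in sequentially. \<rho> k * real k powr (2 * \<alpha> - 3) * real k powr (3 - 2 * \<alpha>) = \<rho> k"
    using eventually_gt_at_top[of 0]
    by eventually_elim (simp add: mult.assoc flip: powr_add)
  consider "2 * \<alpha> > 3" | "2 * \<alpha> < 3" | "2 * \<alpha> = 3" by linarith
  thus ?thesis
  proof cases
    case 1
    have "(\<lambda>k. real k powr (3 - 2 * \<alpha>)) \<longlonglongrightarrow> 0"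
      using 1 by real_asymp
    from tendsto_mult[OF \<rho>_lim this] have "\<rho> \<longlonglongrightarrow> 0"
      using \<rho>_eq by (simp add: Lim_transform_eventually)
    thus ?thesis
      unfolding \<rho>_def by (rule norm_summable_ratio_limit) (auto simp: nz)
  next
    case 2
    \<comment> \<open>The ratios tend to infinity, so this case contradicts the assumed convergence
      of \<open>t\<close>.\<close>
    have "filterlim (\<lambda>k. real k powr (3 - 2 * \<alpha>)) at_top sequentially"
      using 2 by real_asymp
    from filterlim_tendsto_pos_mult_at_top[OF \<rho>_lim \<open>M > 0\<close> this]
    have "filterlim \<rho> at_top sequentially"
      using filterlim_cong[OF refl refl \<rho>_eq] by simp
    hence "\<forall>\<^sub>F k in sequentially. \<rho> k \<ge> 1"
      unfolding filterlim_at_top by blast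
    with not_summable_ratio_ge_1[of t] nz t show ?thesis
      unfolding \<rho>_def by blast
  next
    case 3
    hence \<alpha>: "\<alpha> = 3 / 2" by simp
    have "(\<lambda>k. real k powr (3 - 2 * \<alpha>)) \<longlonglongrightarrow> 1"
      unfolding \<alpha> by real_asymp
    from tendsto_mult[OF \<rho>_lim this] have \<rho>_M: "\<rho> \<longlonglongrightarrow> M"
      using \<rho>_eq by (simp add: Lim_transform_eventually)
    have "L * L = (2 / 3) powr (3 / 2 + 3 / 2)"
      unfolding L_def \<alpha> powr_add by simp
    hence LL: "L * L = 8 / 27"
      by (simp add: eval_nat_numeral)
    have M: "M = 4 / (27 * \<delta>)"
      unfolding M_def LL by (simp add: \<alpha>)
    consider "M < 1" | "M > 1" | "M = 1" by linarith
    thus ?thesis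
    proof cases
      case 1
      thus ?thesis
        using \<rho>_M unfolding \<rho>_def by (intro norm_summable_ratio_limit) (auto simp: nz)
    next
      case 2
      have "\<forall>\<^sub>F k in sequentially. \<rho> k \<ge> 1"
        using order_tendstoD(1)[OF \<rho>_M 2] by eventually_elim simp
      with not_summable_ratio_ge_1[of t] nz t show ?thesis
        unfolding \<rho>_def by blast
    next
      case 3
      \<comment> \<open>The ratio test is silent. Now \<open>4 / \<delta> = 27\<close>, whose powers
        cancel the \<open>27 ^ k\<close> from triplication of
        \<open>pochhammer \<beta> (3 * k)\<close>. Up to the constant \<open>Gamma \<beta>\<close>,
        \<open>t k\<close> becomes a quotient of five Pochhammer symbols by five.\<close>
      hence \<delta>: "\<delta> = 4 / 27" using M pos by (simp add: field_simps)
      define as where "as = [a1 / 2, (a1 + 1) / 2, a2 / 2, (a2 + 1) / 2, 1 / 2]"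
      define bs where "bs = [b1 / 2, (b1 + 1) / 2, of_real (\<beta> / 3), of_real (\<beta> / 3 + 1 / 3), of_real (\<beta> / 3 + 2 / 3)]"
      have half_nonpos: "z / 2 \<notin> \<int>\<^sub>\<le>\<^sub>0" "(z + 1) / 2 \<notin> \<int>\<^sub>\<le>\<^sub>0" if "z \<notin> \<int>\<^sub>\<le>\<^sub>0" for z :: complex
      proof -
        have "z = - of_nat (2 * n)" if "z / 2 = - of_nat n" for n
          using that by (simp add: field_simps)
        moreover have "z = - of_nat (2 * n + 1)" if "(z + 1) / 2 = - of_nat n" for n
          using that by (simp add: field_simps) (simp add: algebra_simps eq_neg_iff_add_eq_0)
        ultimately show "z / 2 \<notin> \<int>\<^sub>\<le>\<^sub>0" "(z + 1) / 2 \<notin> \<int>\<^sub>\<le>\<^sub>0"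
          using that by (metis nonpos_Ints_cases' minus_of_nat_in_nonpos_Ints)+
      qed
      have pos_nonpos: "complex_of_real y \<notin> \<int>\<^sub>\<le>\<^sub>0" if "y > 0" for y
      proof
        assume "complex_of_real y \<in> \<int>\<^sub>\<le>\<^sub>0"
        then obtain n where "complex_of_real y = - of_nat n"
          by (rule nonpos_Ints_cases')
        hence "Re (complex_of_real y) = Re (- of_nat n)" by (rule arg_cong)
        thus False using that by simp
      qed
      have "1 / 2 \<notin> (\<int>\<^sub>\<le>\<^sub>0 :: complex set)"
        using pos_nonpos[of "1 / 2"] by simp
      hence as: "set as \<inter> \<int>\<^sub>\<le>\<^sub>0 = {}"
        using half_nonpos False by (simp add: as_def)
      have bs: "set bs \<inter> \<int>\<^sub>\<le>\<^sub>0 = {}"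
        using half_nonpos b1 pos pos_nonpos[of "\<beta> / 3"] pos_nonpos[of "\<beta> / 3 + 1 / 3"]
          pos_nonpos[of "\<beta> / 3 + 2 / 3"] by (simp add: bs_def)
      define q where "q k = (\<Prod>a\<leftarrow>as. pochhammer a k) / (\<Prod>b\<leftarrow>bs. pochhammer b k)" for k
      have G: "Gamma \<beta> \<noteq> 0" using Gamma_real_pos[OF \<open>\<beta> > 0\<close>] by linarith
      have t_q: "t k = q k / of_real (Gamma \<beta>)" for k
      proof -
        have "\<beta> \<notin> \<int>\<^sub>\<le>\<^sub>0" using pos by (auto elim!: nonpos_Ints_cases)
        hence "Gamma (3 * real k + \<beta>) = Gamma \<beta> * pochhammer \<beta> (3 * k)"
          using pochhammer_Gamma[of \<beta> "3 * k"] G by (simp add: add.commute)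
        also have "pochhammer \<beta> (3 * k) = 27 ^ k * pochhammer (\<beta> / 3) k *
            pochhammer (\<beta> / 3 + 1 / 3) k * pochhammer (\<beta> / 3 + 2 / 3) k"
          using pochhammer_triple[of "\<beta> / 3" k] by simp
        finally have "complex_of_real (Gamma (3 * real k + \<beta>)) = of_real (Gamma \<beta>) * 27 ^ k *
            (pochhammer (of_real (\<beta> / 3)) k *
            pochhammer (of_real (\<beta> / 3 + 1 / 3)) k * pochhammer (of_real (\<beta> / 3 + 2 / 3)) k)"
          unfolding pochhammer_of_real by simp
        thus ?thesis
          unfolding t_def hyp_ML_term_def q_def as_def bs_def \<delta> \<open>2 * \<alpha> = 3\<close> by simp
      qed
      have "(\<lambda>k. q k / of_nat k powr (sum_list as - sum_list bs) / of_real (Gamma \<beta>)) \<longlonglongrightarrow>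
          (\<Prod>b\<leftarrow>bs. Gamma b) / (\<Prod>a\<leftarrow>as. Gamma a) / of_real (Gamma \<beta>)"
        unfolding q_def using as bs G
        by (intro tendsto_divide tendsto_const pochhammer_quotients_asymp) (auto simp: as_def bs_def)
      hence "(\<lambda>k. t k / of_nat k powr (sum_list as - sum_list bs)) \<longlonglongrightarrow>
          (\<Prod>b\<leftarrow>bs. Gamma b) / (\<Prod>a\<leftarrow>as. Gamma a) / of_real (Gamma \<beta>)"
        by (simp add: t_q mult_ac)
      \<comment> \<open>\<open>Gamma\<close> takes the default value 0 at its poles and vanishes
        nowhere else, so the limit is nonzero because all parameters avoid the poles.\<close>
      moreover have "(\<Prod>b\<leftarrow>bs. Gamma b) / (\<Prod>a\<leftarrow>as. Gamma a) / of_real (Gamma \<beta>) \<noteq> 0"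
        using as bs G by (auto simp: prod_list_zero_iff Gamma_eq_zero_iff)
      ultimately show ?thesis
        using t by (rule norm_summable_powr_asymp)
    qed
  qed
qed

section \<open>Gaussian moments and termwise integration\<close>

text \<open>The weight is \<open>sqrt (pi / \<delta>)\<close> times the centred normal density of
  variance \<open>1 / (2 * \<delta>)\<close>. The even moments simplify by
  \<open>fact (2 * k) = 4 ^ k * fact k * pochhammer (1 / 2) k\<close>.\<close>

lemma gaussian_moment_scaled:
  fixes \<delta> :: real
  assumes "\<delta> > 0"
  shows "has_bochner_integral lborel (\<lambda>u. exp (- \<delta> * u\<^sup>2) * u ^ (2 * k))
           (sqrt (pi / \<delta>) * (pochhammer (1 / 2) k / \<delta> ^ k))"
    and "has_bochner_integral lborel (\<lambda>u. exp (- \<delta> * u\<^sup>2) * u ^ (2 * k + 1)) 0"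
proof -
  define \<sigma> where "\<sigma> = sqrt (1 / (2 * \<delta>))"
  have \<sigma>: "\<sigma>\<^sup>2 = 1 / (2 * \<delta>)" using assms by (simp add: \<sigma>_def)
  have "\<sigma> > 0" using assms by (simp add: \<sigma>_def)
  have density: "sqrt (pi / \<delta>) * (normal_density 0 \<sigma> u * y) = exp (- \<delta> * u\<^sup>2) * y" for u y
    using assms by (simp add: normal_density_def \<sigma> real_sqrt_divide)
  have "has_bochner_integral lborel (\<lambda>u. sqrt (pi / \<delta>) * (normal_density 0 \<sigma> u * (u - 0) ^ (2 * k)))
      (sqrt (pi / \<delta>) * (fact (2 * k) / ((2 / \<sigma>\<^sup>2) ^ k * fact k)))"
    using \<open>\<sigma> > 0\<close> by (intro has_bochner_integral_mult_right normal_moment_even)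
  moreover have "fact (2 * k) / ((2 / \<sigma>\<^sup>2) ^ k * fact k) = pochhammer (1 / 2) k / \<delta> ^ k"
    using assms unfolding fact_double \<sigma> by (simp add: power_mult power_mult_distrib)
  ultimately show "has_bochner_integral lborel (\<lambda>u. exp (- \<delta> * u\<^sup>2) * u ^ (2 * k))
           (sqrt (pi / \<delta>) * (pochhammer (1 / 2) k / \<delta> ^ k))"
    unfolding density by simp
  have "has_bochner_integral lborel (\<lambda>u. sqrt (pi / \<delta>) * (normal_density 0 \<sigma> u * (u - 0) ^ (2 * k + 1)))
      (sqrt (pi / \<delta>) * 0)"
    using \<open>\<sigma> > 0\<close> by (intro has_bochner_integral_mult_right normal_moment_odd)
  thus "has_bochner_integral lborel (\<lambda>u. exp (- \<delta> * u\<^sup>2) * u ^ (2 * k + 1)) 0"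
    unfolding density by simp
qed

lemma summable_even_odd:
  fixes f :: "nat \<Rightarrow> real"
  assumes "summable (\<lambda>k. f (2 * k))" "summable (\<lambda>k. f (2 * k + 1))"
  shows "summable f"
proof -
  have "(\<lambda>n. if even n then f (2 * (n div 2)) else f (2 * ((n - 1) div 2) + 1)) sums
      ((\<Sum>k. f (2 * k + 1)) + (\<Sum>k. f (2 * k)))"
    using assms by (intro sums_if summable_sums)
  moreover have "(\<lambda>n. if even n then f (2 * (n div 2)) else f (2 * ((n - 1) div 2) + 1)) = f"
    by (auto simp: fun_eq_iff elim!: oddE)
  ultimately show ?thesis by (simp add: sums_iff)
qed

theorem theorem7:
  fixes \<alpha> \<beta> \<delta> :: real and a1 a2 b1 :: complex
  assumes "\<alpha> > 0" and "\<beta> > 0" and "\<delta> > 0"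
    and "b1 \<notin> \<int>\<^sub>\<le>\<^sub>0"
    and "summable (hyp_ML_term (2 * \<alpha>) \<beta>
           [a1 / 2, (a1 + 1) / 2, a2 / 2, (a2 + 1) / 2, 1 / 2] [b1 / 2, (b1 + 1) / 2]
           (complex_of_real (4 / \<delta>)))"
  shows "(\<forall>u::real. summable (hyp_ML_term \<alpha> \<beta> [a1, a2] [b1] (complex_of_real u))) \<and>
    integrable lborel
      (\<lambda>u::real. complex_of_real (exp (- \<delta> * u\<^sup>2)) * hyp_ML \<alpha> \<beta> [a1, a2] [b1] (complex_of_real u)) \<and>
    (\<integral>u. complex_of_real (exp (- \<delta> * u\<^sup>2)) * hyp_ML \<alpha> \<beta> [a1, a2] [b1] (complex_of_real u) \<partial>lborel)
      = complex_of_real (sqrt (pi / \<delta>)) *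
        hyp_ML (2 * \<alpha>) \<beta>
          [a1 / 2, (a1 + 1) / 2, a2 / 2, (a2 + 1) / 2, 1 / 2] [b1 / 2, (b1 + 1) / 2]
          (complex_of_real (4 / \<delta>))"
proof -
  define c where "c = hyp_ML_term \<alpha> \<beta> [a1, a2] [b1] 1"
  define t where "t = hyp_ML_term (2 * \<alpha>) \<beta> [a1 / 2, (a1 + 1) / 2, a2 / 2, (a2 + 1) / 2, 1 / 2]
    [b1 / 2, (b1 + 1) / 2] (complex_of_real (4 / \<delta>))"
  define f where "f n u = c n * complex_of_real (exp (- \<delta> * u\<^sup>2) * u ^ n)" for n u
  define I where "I n = (\<integral>u. norm (f n u) \<partial>lborel)" for n
  have t_eq: "t k = c (2 * k) * of_real (pochhammer (1 / 2) k / \<delta> ^ k)" for k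
    unfolding t_def c_def by (rule hyp_ML_term_even[OF \<open>\<delta> > 0\<close>])
  have t_abs: "summable (\<lambda>k. norm (t k))"
    unfolding t_def by (rule hyp_ML_even_norm_summable) fact+
  have f_even: "has_bochner_integral lborel (f (2 * k)) (of_real (sqrt (pi / \<delta>)) * t k)" for k
  proof -
    have "has_bochner_integral lborel (f (2 * k))
        (c (2 * k) * of_real (sqrt (pi / \<delta>) * (pochhammer (1 / 2) k / \<delta> ^ k)))"
      unfolding f_def
      by (intro has_bochner_integral_mult_right has_bochner_integral_of_real gaussian_moment_scaled assms)
    thus ?thesis by (simp add: t_eq mult_ac)
  qed
  have f_odd: "has_bochner_integral lborel (f (2 * k + 1)) 0" for k
  proof -
    have "has_bochner_integral lborel (f (2 * k + 1)) (c (2 * k + 1) * of_real 0)"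
      unfolding f_def
      by (intro has_bochner_integral_mult_right has_bochner_integral_of_real gaussian_moment_scaled assms)
    thus ?thesis by simp
  qed
  have f_int: "integrable lborel (f n)" for n
    using f_even[of "n div 2"] f_odd[of "n div 2"]
    by (cases "even n") (auto elim!: oddE simp: has_bochner_integral_iff)
  have norm_f: "norm (f n u) = exp (- \<delta> * u\<^sup>2) * (norm (c n) * \<bar>u\<bar> ^ n)" for n u
    by (simp add: f_def norm_mult norm_power)
  have I_even: "I (2 * k) = sqrt (pi / \<delta>) * norm (t k)" for k
  proof -
    have "norm (f (2 * k) u) = norm (c (2 * k)) * (exp (- \<delta> * u\<^sup>2) * u ^ (2 * k))" for u
      unfolding norm_f by (simp add: power_even_abs)
    hence "I (2 * k) = norm (c (2 * k)) * (sqrt (pi / \<delta>) * (pochhammer (1 / 2) k / \<delta> ^ k))"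
      using gaussian_moment_scaled(1)[OF \<open>\<delta> > 0\<close>, of k]
      by (simp only: I_def integral_mult_right_zero has_bochner_integral_integral_eq)
    also have "\<dots> = sqrt (pi / \<delta>) * norm (t k)"
      using \<open>\<delta> > 0\<close> pochhammer_pos[of "1 / 2 :: real" k]
      by (simp add: t_eq norm_mult norm_divide norm_power)
    finally show ?thesis .
  qed
  have I_even_summable: "summable (\<lambda>k. I (2 * k))"
    unfolding I_even by (intro summable_mult t_abs)
  \<comment> \<open>The vanishing odd moments say nothing about the integrals of the norms for odd
    index, so these are bounded by their even neighbours.\<close>
  have "\<forall>\<^sub>F n in sequentially. I (Suc n) \<le> I n + I (Suc (Suc n))"
    using hyp_ML_coeff_square_le[OF \<open>\<alpha> > 0\<close> \<open>\<beta> > 0\<close> \<open>b1 \<notin> \<int>\<^sub>\<le>\<^sub>0\<close>, of a1 a2]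
  proof eventually_elim
    case (elim n)
    have "norm (f (Suc n) u) \<le> norm (f n u) + norm (f (Suc (Suc n)) u)" for u
    proof -
      \<comment> \<open>The coefficient inequality becomes \<open>y\<^sup>2 \<le> 4 * x * z\<close>,
        because the powers of \<open>\<bar>u\<bar>\<close> match; the arithmetic-geometric mean
        inequality then gives \<open>y \<le> x + z\<close>.\<close>
      define x y z where "x = norm (c n) * \<bar>u\<bar> ^ n" and "y = norm (c (Suc n)) * \<bar>u\<bar> ^ Suc n"
        and "z = norm (c (Suc (Suc n))) * \<bar>u\<bar> ^ Suc (Suc n)"
      have "y\<^sup>2 = (norm (c (Suc n)))\<^sup>2 * (\<bar>u\<bar> ^ Suc n)\<^sup>2"
        by (simp add: y_def power_mult_distrib)
      also have "\<dots> \<le> 4 * norm (c n) * norm (c (Suc (Suc n))) * (\<bar>u\<bar> ^ Suc n)\<^sup>2"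
        using elim unfolding c_def by (intro mult_right_mono) auto
      also have "\<dots> = 4 * x * z"
        by (simp add: x_def z_def power2_eq_square mult_ac)
      also have "\<dots> \<le> (x + z)\<^sup>2"
        using zero_le_power2[of "x - z"] by (simp add: power2_eq_square algebra_simps)
      finally have "y \<le> x + z"
        by (rule power2_le_imp_le) (simp add: x_def z_def)
      thus ?thesis
        unfolding norm_f x_def y_def z_def by (simp flip: distrib_left)
    qed
    hence "I (Suc n) \<le> (\<integral>u. norm (f n u) + norm (f (Suc (Suc n)) u) \<partial>lborel)"
      unfolding I_def by (intro integral_mono integrable_norm Bochner_Integration.integrable_add f_int)
    also have "\<dots> = I n + I (Suc (Suc n))"
      unfolding I_def by (intro Bochner_Integration.integral_add integrable_norm f_int)
    finally show ?case .
  qed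
  hence "\<forall>\<^sub>F k in sequentially. I (Suc (2 * k)) \<le> I (2 * k) + I (Suc (Suc (2 * k)))"
    by (rule eventually_compose_filterlim) (rule mult_nat_left_at_top, simp)
  hence "\<forall>\<^sub>F k in sequentially. norm (I (2 * k + 1)) \<le> I (2 * k) + I (2 * Suc k)"
    by eventually_elim (simp add: I_def)
  moreover have "summable (\<lambda>k. I (2 * k) + I (2 * Suc k))"
    using I_even_summable by (intro summable_add) (simp_all only: summable_Suc_iff[of "\<lambda>k. I (2 * k)"])
  ultimately have "summable (\<lambda>k. I (2 * k + 1))"
    by (rule summable_comparison_test_ev)
  with I_even_summable have I_summable: "summable I"
    by (rule summable_even_odd)
  have abs_summable: "summable (\<lambda>n. norm (c n) * \<bar>u\<bar> ^ n)" for u :: real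
  proof -
    \<comment> \<open>Summability of the integrals yields convergence at every point: on the unit
      interval \<open>[\<bar>u\<bar>, \<bar>u\<bar> + 1]\<close> the Gaussian is at least
      \<open>K\<close> and the power at least \<open>\<bar>u\<bar> ^ n\<close>, so
      \<open>I n\<close> dominates \<open>K\<close> times the term at
      \<open>\<bar>u\<bar>\<close>.\<close>
    define K where "K = exp (- \<delta> * (\<bar>u\<bar> + 1)\<^sup>2)"
    have "K * (norm (c n) * \<bar>u\<bar> ^ n) \<le> I n" for n
    proof -
      have "K * (norm (c n) * \<bar>u\<bar> ^ n) =
          (\<integral>v. indicator {\<bar>u\<bar>..\<bar>u\<bar> + 1} v * (K * (norm (c n) * \<bar>u\<bar> ^ n)) \<partial>lborel)"
        by simp
      also have "\<dots> \<le> I n"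
        unfolding I_def
      proof (rule integral_mono)
        show "integrable lborel (\<lambda>v. indicator {\<bar>u\<bar>..\<bar>u\<bar> + 1} v * (K * (norm (c n) * \<bar>u\<bar> ^ n)))"
          by simp
        show "integrable lborel (\<lambda>v. norm (f n v))"
          by (intro integrable_norm f_int)
        fix v :: real
        have "K * (norm (c n) * \<bar>u\<bar> ^ n) \<le> norm (f n v)" if v: "v \<in> {\<bar>u\<bar>..\<bar>u\<bar> + 1}"
          unfolding norm_f K_def using v \<open>\<delta> > 0\<close>
          by (intro mult_mono) (auto intro!: power_mono mult_left_mono)
        thus "indicator {\<bar>u\<bar>..\<bar>u\<bar> + 1} v * (K * (norm (c n) * \<bar>u\<bar> ^ n)) \<le> norm (f n v)"
          by (auto simp: indicator_def)
      qed
      finally show ?thesis .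
    qed
    hence "summable (\<lambda>n. K * (norm (c n) * \<bar>u\<bar> ^ n))"
      by (intro summable_comparison_test'[OF I_summable, of 0]) (simp add: K_def)
    thus ?thesis
      by (simp add: K_def summable_cmult_iff)
  qed
  have term_eq: "hyp_ML_term \<alpha> \<beta> [a1, a2] [b1] (complex_of_real u) = (\<lambda>n. c n * complex_of_real u ^ n)" for u
    by (rule ext, subst hyp_ML_term_eq_coeff_mult_power) (simp add: c_def)
  have summ: "summable (hyp_ML_term \<alpha> \<beta> [a1, a2] [b1] (complex_of_real u))" for u
    unfolding term_eq using abs_summable[of u]
    by (intro summable_norm_cancel[where f = "\<lambda>n. c n * complex_of_real u ^ n"])
      (simp add: norm_mult norm_power)
  have integrand: "complex_of_real (exp (- \<delta> * u\<^sup>2)) * hyp_ML \<alpha> \<beta> [a1, a2] [b1] (complex_of_real u) =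
      (\<Sum>n. f n u)" for u
  proof -
    have "complex_of_real (exp (- \<delta> * u\<^sup>2)) * hyp_ML \<alpha> \<beta> [a1, a2] [b1] (complex_of_real u) =
        (\<Sum>n. complex_of_real (exp (- \<delta> * u\<^sup>2)) * hyp_ML_term \<alpha> \<beta> [a1, a2] [b1] (complex_of_real u) n)"
      unfolding hyp_ML_def by (rule suminf_mult[OF summ, symmetric])
    thus ?thesis by (simp add: term_eq f_def mult_ac)
  qed
  have AE: "AE u in lborel. summable (\<lambda>n. norm (f n u))"
    unfolding norm_f by (intro AE_I2 summable_mult abs_summable)
  note int = f_int AE I_summable[unfolded I_def]
  have "integrable lborel (\<lambda>u. \<Sum>n. f n u)"
    by (rule integrable_suminf[OF int])
  moreover have "(\<integral>u. (\<Sum>n. f n u) \<partial>lborel) = of_real (sqrt (pi / \<delta>)) * (\<Sum>k. t k)"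
  proof -
    have "integral\<^sup>L lborel (f n) = 0" if "n \<notin> range (\<lambda>k. 2 * k)" for n
    proof -
      have "odd n" using that by auto
      thus ?thesis using has_bochner_integral_integral_eq[OF f_odd] by (metis oddE)
    qed
    \<comment> \<open>Terms off the range of doubling integrate to 0, so the series of integrals can
      be reindexed along the even numbers without changing its sum.\<close>
    hence "(\<lambda>k. integral\<^sup>L lborel (f (2 * k))) sums (\<integral>u. (\<Sum>n. f n u) \<partial>lborel)"
      using sums_integral[OF int] by (subst sums_mono_reindex) (auto simp: strict_mono_def)
    moreover have "(\<lambda>k. integral\<^sup>L lborel (f (2 * k))) sums (of_real (sqrt (pi / \<delta>)) * (\<Sum>k. t k))"
      unfolding has_bochner_integral_integral_eq[OF f_even]
      by (intro sums_mult summable_sums summable_norm_cancel[OF t_abs])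
    ultimately show ?thesis by (rule sums_unique2)
  qed
  moreover have "hyp_ML (2 * \<alpha>) \<beta> [a1 / 2, (a1 + 1) / 2, a2 / 2, (a2 + 1) / 2, 1 / 2]
      [b1 / 2, (b1 + 1) / 2] (complex_of_real (4 / \<delta>)) = (\<Sum>k. t k)"
    unfolding hyp_ML_def t_def ..
  ultimately show ?thesis
    unfolding integrand using summ by simp
qed

end
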